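(* Let $(S,\preceq)$ be a meet semi-lattice with least element $m$, and assume that $\preceq$ is well-founded, i.e. there is no infinite strictly decreasing sequence in $S$. Let $F:S\to S$ be a function. If there exists an $F$-meeting point, then there exists $y\in S$ with $y\neq m$ and $y\preceq F(y)$.
   Context: A meet semi-lattice is a partially ordered set in which any two elements have a greatest lower bound. Then every non-empty finite subset has a greatest lower bound, denoted $\inf$. Let $(S,\preceq)$ be a meet semi-lattice with least element $m$ and $F:S\to S$. An element $x\in S$ is an $F$-meeting point if $x\neq m$ and, for all $n\ge 1$ and all $x_1,\dots,x_n\in S$ with $m\neq x_1\preceq\dots\preceq x_n\preceq x$, one has $\inf(F(x_1),\dots,F(x_n),x)\neq m$. *)

theory Defs imports Main begin

definition meeting_point ::
    "('a::{semilattice_inf, order_bot} \<Rightarrow> 'a) \<Rightarrow> 'a \<Rightarrow> bool" where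
  "meeting_point F x \<longleftrightarrow>
     x \<noteq> bot \<and>
     (\<forall>n\<ge>1. \<forall>xs :: nat \<Rightarrow> 'a.
        xs 1 \<noteq> bot \<and> (\<forall>i\<in>{1..<n}. xs i \<le> xs (Suc i)) \<and> xs n \<le> x \<longrightarrow>
        Inf_fin (insert x ((\<lambda>i. F (xs i)) ` {1..n})) \<noteq> bot)"

end

(* Iterate z \<mapsto> inf z (F z) from a meeting point x. The (k+1)-st iterate is the infimum of x
   and the values of F at the first k+1 iterates; these form a chain below x, so the meeting
   property keeps the iterates away from bot. By well-foundedness the decreasing sequence of
   iterates stalls, and where it stalls y \<le> F y. *)
theory Submission imports Defs begin

text \<open>Each iteration step adjoins one more value of \<open>F\<close> to the finite infimum.
  This brings the iterates into the form occurring in \<open>meeting_point\<close>.\<close>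

lemma funpow_inf_eq_Inf_fin:
  fixes F :: "'a::semilattice_inf \<Rightarrow> 'a" and x :: 'a
  defines "y \<equiv> \<lambda>k. ((\<lambda>z. inf z (F z)) ^^ k) x"
  shows "y (Suc k) = Inf_fin (insert x ((\<lambda>j. F (y j)) ` {..k}))"
proof (induction k)
  case 0
  show ?case by (simp add: y_def)
next
  case (Suc k)
  have "y (Suc (Suc k)) = inf (F (y (Suc k))) (y (Suc k))"
    by (simp add: y_def inf_commute)
  also have "\<dots> = Inf_fin (insert (F (y (Suc k))) (insert x ((\<lambda>j. F (y j)) ` {..k})))"
    by (subst Suc) (rule Inf_fin.insert[symmetric], simp_all)
  finally show ?case
    by (simp only: atMost_Suc image_insert insert_commute)
qed

text \<open>Induction: if the \<open>k\<close>-th iterate is not \<open>bot\<close>, the iterates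
  \<open>0\<close> to \<open>k\<close> form a chain to which the meeting property applies with
  \<open>n = Suc k\<close>.\<close>

lemma meeting_point_funpow_neq_bot:
  assumes "meeting_point F x"
  shows "((\<lambda>z. inf z (F z)) ^^ k) x \<noteq> bot"
proof (induction k)
  case 0
  show ?case using assms by (simp add: meeting_point_def)
next
  case (Suc k)
  define y where "y = (\<lambda>k. ((\<lambda>z. inf z (F z)) ^^ k) x)"
  \<comment> \<open>The iterates decrease while \<open>meeting_point\<close> asks for an increasing
    chain indexed from 1, hence the reversal: \<open>xs 1 = y k\<close> and
    \<open>xs (Suc k) = y 0 = x\<close>.\<close>
  define xs where "xs = (\<lambda>i. y (Suc k - i))"
  have "xs i \<le> xs (Suc i)" if "i \<in> {1..<Suc k}" for i
  proof -
    \<comment> \<open>So \<open>xs i\<close> is the iterate following \<open>xs (Suc i)\<close>,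
      hence below it.\<close>
    have "Suc k - i = Suc (Suc k - Suc i)" using that by auto
    then show ?thesis by (simp add: xs_def y_def)
  qed
  moreover have "xs 1 \<noteq> bot" "xs (Suc k) \<le> x"
    using Suc by (simp_all add: xs_def y_def)
  ultimately have "Inf_fin (insert x ((\<lambda>i. F (xs i)) ` {1..Suc k})) \<noteq> bot"
    using assms unfolding meeting_point_def
    by (metis One_nat_def Suc_le_mono le0)
  moreover have "(\<lambda>i. F (xs i)) ` {1..Suc k} = (\<lambda>j. F (y j)) ` {..k}"
  proof -
    have "(\<lambda>i. Suc k - i) ` {1..Suc k} = {..k}"
    proof
      show "{..k} \<subseteq> (\<lambda>i. Suc k - i) ` {1..Suc k}"
      proof
        fix j assume "j \<in> {..k}"
        then show "j \<in> (\<lambda>i. Suc k - i) ` {1..Suc k}"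
          by (intro image_eqI[of _ _ "Suc k - j"]) auto
      qed
    qed auto
    then have "(\<lambda>j. F (y j)) ` (\<lambda>i. Suc k - i) ` {1..Suc k} = (\<lambda>j. F (y j)) ` {..k}"
      by (rule arg_cong)
    then show ?thesis by (simp only: image_image xs_def)
  qed
  ultimately show ?case
    using funpow_inf_eq_Inf_fin[of k F x] by (simp only: y_def not_False_eq_True)
qed

theorem lemma10:
  fixes F :: "'a::{semilattice_inf, order_bot} \<Rightarrow> 'a"
  assumes "wfp ((<) :: 'a \<Rightarrow> 'a \<Rightarrow> bool)"
    and "\<exists>x. meeting_point F x"
  shows "\<exists>y. y \<noteq> bot \<and> y \<le> F y"
proof -
  obtain x where x: "meeting_point F x" using assms(2) by blast
  define y where "y = (\<lambda>k. ((\<lambda>z. inf z (F z)) ^^ k) x)"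
  have "wf {(a, b). a < (b :: 'a)}"
    using assms(1) by (simp add: wfp_def)
  then obtain k where "\<not> y (Suc k) < y k"
    unfolding wf_iff_no_infinite_down_chain by blast
  moreover have "y (Suc k) = inf (y k) (F (y k))"
    by (simp add: y_def)
  \<comment> \<open>The iterates always decrease weakly, so a step that is not strict is an
    equality.\<close>
  ultimately have "inf (y k) (F (y k)) = y k"
    by (metis inf.cobounded1 less_le)
  then have "y k \<le> F (y k)"
    by (simp add: inf.absorb_iff1)
  moreover have "y k \<noteq> bot"
    using meeting_point_funpow_neq_bot[OF x] by (simp add: y_def)
  ultimately show ?thesis by blast
qed

end
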